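(* Let $R$ be a ring, $n\ge1$, and let $\varphi_{1,n}$, $\varphi_{n,1}$, $\varphi_{1,1}$ be additive isomorphisms of $M_{1,n}(R)=R^n$, $M_{n,1}(R)={}^nR$ and $M_{1,1}(R)=R$ onto themselves, respectively. Let $C\subseteq R^n$ be a code. With the notation of the context, $C$ is self-dual for $*$, i.e. $C=C^{*\perp}$, if and only if $\varphi_{n,1}^{-1}(C^t)=\bigl(\varphi_{1,n}^{-1}(C)\bigr)^{\perp}$. Similarly, if $C={}^{\perp *}C$, then $\varphi_{1,n}^{-1}(C)=\bigl(\varphi_{n,1}^{-1}(C^t)\bigr)^{\perp}$.
   Context: Rings are associative with a unit element, not necessarily commutative. A code here is a subset of $R^n$, not necessarily linear. $R^n$ denotes rows $M_{1,n}(R)$ and ${}^nR$ denotes columns $M_{n,1}(R)$; $x^t$ is the transpose, and $C^t=\{c^t: c\in C\}$. The scalar product $*$ is defined, for $a,b\in R^n$, by $a*b^t=\varphi_{1,1}(\varphi_{1,n}^{-1}(a)\varphi_{n,1}^{-1}(b^t))$. For $C\subseteq R^n$: ${}^{\perp *}C=\{x\in R^n: x*c^t=0\ \forall c\in C\}$ and $C^{*\perp}=\{x\in R^n: c*x^t=0\ \forall c\in C\}$. The symbol $\perp$ alone is the usual orthogonality between rows and columns: for $X\subseteq R^n$, $X^\perp=\{y\in{}^nR: xy=0\ \forall x\in X\}$, and for $Y\subseteq{}^nR$, $Y^\perp=\{x\in R^n: xy=0\ \forall y\in Y\}$, where $xy$ is the usual matrix product. *)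

theory Defs
  imports "Jordan_Normal_Form.Matrix"
begin

text \<open>
  Matrices over a ring \<open>R\<close> are those of \<open>Jordan_Normal_Form\<close>: \<open>M\<^bsub>m,n\<^esub>(R)\<close> is
  \<open>carrier_mat m n\<close>, so \<open>R\<^sup>n\<close> (rows) is \<open>carrier_mat 1 n\<close>, columns are \<open>carrier_mat n 1\<close>, and
  \<open>R\<close> itself is identified with \<open>carrier_mat 1 1\<close>, with zero \<open>0\<^sub>m 1 1\<close>.  The sort
  \<open>{ring, monoid_mult}\<close> is that of associative unital, not necessarily commutative rings; unlike
  \<open>ring_1\<close> it does not exclude the zero ring.
\<close>

text \<open>
  \<open>monoid_mat TYPE('a) m n\<close> has matrix addition as its operation, so its HOL-Algebra
  isomorphisms are the additive ones.
\<close>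

definition additive_automorphism :: "nat \<Rightarrow> nat \<Rightarrow> ('a :: monoid_add mat \<Rightarrow> 'a mat) \<Rightarrow> bool" where
  "additive_automorphism m n \<phi> \<longleftrightarrow> \<phi> \<in> iso (monoid_mat TYPE('a) m n) (monoid_mat TYPE('a) m n)"

text \<open>\<open>inv_into A \<phi>\<close> is the inverse of \<open>\<phi>\<close> only on \<open>\<phi> ` A\<close>, hence the explicit carriers.\<close>

abbreviation row_inv :: "nat \<Rightarrow> ('a mat \<Rightarrow> 'a mat) \<Rightarrow> 'a mat \<Rightarrow> 'a mat" where
  "row_inv n \<phi> \<equiv> inv_into (carrier_mat 1 n) \<phi>"

abbreviation col_inv :: "nat \<Rightarrow> ('a mat \<Rightarrow> 'a mat) \<Rightarrow> 'a mat \<Rightarrow> 'a mat" where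
  "col_inv n \<phi> \<equiv> inv_into (carrier_mat n 1) \<phi>"

text \<open>The scalar product of a row \<open>a\<close> and a column \<open>b\<close>.\<close>

definition star_prod ::
  "nat \<Rightarrow> ('a :: semiring_0 mat \<Rightarrow> 'a mat) \<Rightarrow> ('a mat \<Rightarrow> 'a mat) \<Rightarrow> ('a mat \<Rightarrow> 'a mat)
    \<Rightarrow> 'a mat \<Rightarrow> 'a mat \<Rightarrow> 'a mat" where
  "star_prod n \<phi>1n \<phi>n1 \<phi>11 a b = \<phi>11 (row_inv n \<phi>1n a * col_inv n \<phi>n1 b)"

definition left_star_perp ::
  "nat \<Rightarrow> ('a :: semiring_0 mat \<Rightarrow> 'a mat) \<Rightarrow> ('a mat \<Rightarrow> 'a mat) \<Rightarrow> ('a mat \<Rightarrow> 'a mat)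
    \<Rightarrow> 'a mat set \<Rightarrow> 'a mat set" where
  "left_star_perp n \<phi>1n \<phi>n1 \<phi>11 C =
    {x \<in> carrier_mat 1 n. \<forall>c\<in>C. star_prod n \<phi>1n \<phi>n1 \<phi>11 x (transpose_mat c) = 0\<^sub>m 1 1}"

definition right_star_perp ::
  "nat \<Rightarrow> ('a :: semiring_0 mat \<Rightarrow> 'a mat) \<Rightarrow> ('a mat \<Rightarrow> 'a mat) \<Rightarrow> ('a mat \<Rightarrow> 'a mat)
    \<Rightarrow> 'a mat set \<Rightarrow> 'a mat set" where
  "right_star_perp n \<phi>1n \<phi>n1 \<phi>11 C =
    {x \<in> carrier_mat 1 n. \<forall>c\<in>C. star_prod n \<phi>1n \<phi>n1 \<phi>11 c (transpose_mat x) = 0\<^sub>m 1 1}"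

definition perp_of_rows :: "nat \<Rightarrow> 'a :: semiring_0 mat set \<Rightarrow> 'a mat set" where
  "perp_of_rows n X = {y \<in> carrier_mat n 1. \<forall>x\<in>X. x * y = 0\<^sub>m 1 1}"

definition perp_of_cols :: "nat \<Rightarrow> 'a :: semiring_0 mat set \<Rightarrow> 'a mat set" where
  "perp_of_cols n Y = {x \<in> carrier_mat 1 n. \<forall>y\<in>Y. x * y = 0\<^sub>m 1 1}"

end

theory Submission
  imports Defs
begin

text \<open>
  The additive isomorphisms act as mere changes of coordinates.  The outer map \<open>\<phi>11\<close> is additive
  and injective, so it neither creates nor destroys zeros; hence \<open>a\<close> and \<open>b\<close> are orthogonal
  for the scalar product \<open>*\<close> exactly when \<open>\<phi>1n\<inverse>(a)\<close> and \<open>\<phi>n1\<inverse>(b)\<close> are orthogonal in the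
  ordinary sense (\<open>star_prod_eq_zero_iff\<close>).  As \<open>\<phi>1n\<inverse>\<close> and \<open>\<phi>n1\<inverse>\<close> permute all rows and all
  columns, they carry each orthogonal for \<open>*\<close> bijectively onto an ordinary orthogonal
  (\<open>col_inv_image_right_star_perp\<close> and \<open>row_inv_image_left_star_perp\<close>).  Self-duality for \<open>*\<close> thus
  translates into the stated equations, and the first of them translates back because
  \<open>x \<mapsto> \<phi>n1\<inverse>(x\<^sup>t)\<close> is injective on rows.
\<close>

lemma additive_automorphism_bij_betw:
  assumes "additive_automorphism m n (\<phi> :: 'a :: monoid_add mat \<Rightarrow> 'a mat)"
  shows "bij_betw \<phi> (carrier_mat m n) (carrier_mat m n)"
  using assms by (simp add: additive_automorphism_def iso_def monoid_mat_def)

lemma additive_automorphism_inv_bij_betw: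
  assumes "additive_automorphism m n (\<phi> :: 'a :: monoid_add mat \<Rightarrow> 'a mat)"
  shows "bij_betw (inv_into (carrier_mat m n) \<phi>) (carrier_mat m n) (carrier_mat m n)"
  using assms by (intro bij_betw_inv_into additive_automorphism_bij_betw)

lemma additive_automorphism_zero:
  assumes \<phi>: "additive_automorphism m n (\<phi> :: 'a :: monoid_add mat \<Rightarrow> 'a mat)"
  shows "\<phi> (0\<^sub>m m n) = 0\<^sub>m m n"
proof -
  \<comment> \<open>Surjectivity replaces cancellation: a preimage \<open>z\<close> of zero satisfies
    \<open>\<phi> 0 = \<phi> 0 + \<phi> z = \<phi> (0 + z) = \<phi> z = 0\<close>.\<close>
  have bij: "bij_betw \<phi> (carrier_mat m n) (carrier_mat m n)"
    using \<phi> by (rule additive_automorphism_bij_betw)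
  have add: "\<phi> (A + B) = \<phi> A + \<phi> B" if "A \<in> carrier_mat m n" "B \<in> carrier_mat m n" for A B
    using \<phi> that by (auto simp: additive_automorphism_def iso_def hom_def monoid_mat_def)
  obtain z where z: "z \<in> carrier_mat m n" "\<phi> z = 0\<^sub>m m n"
    using bij by (metis bij_betw_imp_surj_on imageE zero_carrier_mat)
  have "\<phi> (0\<^sub>m m n) \<in> carrier_mat m n"
    using bij by (simp add: bij_betwE)
  then have "\<phi> (0\<^sub>m m n) = \<phi> (0\<^sub>m m n) + \<phi> z"
    using z by simp
  also have "\<dots> = 0\<^sub>m m n"
    using add[of "0\<^sub>m m n" z] z by simp
  finally show ?thesis .
qed

lemma additive_automorphism_eq_zero_iff:
  assumes "additive_automorphism m n (\<phi> :: 'a :: monoid_add mat \<Rightarrow> 'a mat)"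
    and "A \<in> carrier_mat m n"
  shows "\<phi> A = 0\<^sub>m m n \<longleftrightarrow> A = 0\<^sub>m m n"
  using additive_automorphism_zero[OF assms(1)] additive_automorphism_bij_betw[OF assms(1)] assms(2)
  by (metis bij_betw_imp_inj_on inj_on_eq_iff zero_carrier_mat)

lemma star_prod_eq_zero_iff:
  fixes \<phi>1n \<phi>n1 \<phi>11 :: "'a :: semiring_0 mat \<Rightarrow> 'a mat"
  assumes \<phi>1n: "additive_automorphism 1 n \<phi>1n" and \<phi>n1: "additive_automorphism n 1 \<phi>n1"
    and \<phi>11: "additive_automorphism 1 1 \<phi>11"
    and ab: "a \<in> carrier_mat 1 n" "b \<in> carrier_mat n 1"
  shows "star_prod n \<phi>1n \<phi>n1 \<phi>11 a b = 0\<^sub>m 1 1 \<longleftrightarrow> row_inv n \<phi>1n a * col_inv n \<phi>n1 b = 0\<^sub>m 1 1"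
proof -
  have "row_inv n \<phi>1n a \<in> carrier_mat 1 n" "col_inv n \<phi>n1 b \<in> carrier_mat n 1"
    using ab additive_automorphism_inv_bij_betw[OF \<phi>1n] additive_automorphism_inv_bij_betw[OF \<phi>n1]
    by (auto dest: bij_betwE)
  then have "row_inv n \<phi>1n a * col_inv n \<phi>n1 b \<in> carrier_mat 1 1"
    by (rule mult_carrier_mat)
  then show ?thesis
    unfolding star_prod_def by (rule additive_automorphism_eq_zero_iff[OF \<phi>11])
qed

lemma bij_betw_transpose_mat: "bij_betw transpose_mat (carrier_mat m n) (carrier_mat n m)"
  by (rule bij_betw_byWitness[where f' = transpose_mat]) auto

text \<open>
  The conditions defining the two orthogonals agree pointwise under \<open>x \<mapsto> \<phi>n1\<inverse>(x\<^sup>t)\<close>; since this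
  map sends the rows onto all of the columns, every ordinary orthogonal column is reached.
\<close>

lemma col_inv_image_right_star_perp:
  fixes \<phi>1n \<phi>n1 \<phi>11 :: "'a :: semiring_0 mat \<Rightarrow> 'a mat"
  assumes \<phi>: "additive_automorphism 1 n \<phi>1n" "additive_automorphism n 1 \<phi>n1"
      "additive_automorphism 1 1 \<phi>11"
    and C: "C \<subseteq> carrier_mat 1 n"
  shows "col_inv n \<phi>n1 ` (transpose_mat ` right_star_perp n \<phi>1n \<phi>n1 \<phi>11 C)
    = perp_of_rows n (row_inv n \<phi>1n ` C)"
proof -
  have "bij_betw (col_inv n \<phi>n1 \<circ> transpose_mat) (carrier_mat 1 n) (carrier_mat n 1)"
    using bij_betw_transpose_mat additive_automorphism_inv_bij_betw[OF \<phi>(2)]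
    by (rule bij_betw_trans)
  then have img: "(col_inv n \<phi>n1 \<circ> transpose_mat) ` carrier_mat 1 n = carrier_mat n 1"
    by (rule bij_betw_imp_surj_on)
  have "right_star_perp n \<phi>1n \<phi>n1 \<phi>11 C
      = {x \<in> carrier_mat 1 n. \<forall>c\<in>C. row_inv n \<phi>1n c * (col_inv n \<phi>n1 \<circ> transpose_mat) x = 0\<^sub>m 1 1}"
    using C unfolding right_star_perp_def
    by (auto simp: star_prod_eq_zero_iff[OF \<phi>] subset_iff simp del: One_nat_def)
  moreover have "perp_of_rows n X
      = {y \<in> (col_inv n \<phi>n1 \<circ> transpose_mat) ` carrier_mat 1 n. \<forall>x\<in>X. x * y = 0\<^sub>m 1 1}" for X
    unfolding perp_of_rows_def img ..
  ultimately show ?thesis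
    unfolding image_comp by auto
qed

lemma row_inv_image_left_star_perp:
  fixes \<phi>1n \<phi>n1 \<phi>11 :: "'a :: semiring_0 mat \<Rightarrow> 'a mat"
  assumes \<phi>: "additive_automorphism 1 n \<phi>1n" "additive_automorphism n 1 \<phi>n1"
      "additive_automorphism 1 1 \<phi>11"
    and C: "C \<subseteq> carrier_mat 1 n"
  shows "row_inv n \<phi>1n ` left_star_perp n \<phi>1n \<phi>n1 \<phi>11 C
    = perp_of_cols n (col_inv n \<phi>n1 ` (transpose_mat ` C))"
proof -
  have img: "row_inv n \<phi>1n ` carrier_mat 1 n = carrier_mat 1 n"
    using additive_automorphism_inv_bij_betw[OF \<phi>(1)] by (rule bij_betw_imp_surj_on)
  have "left_star_perp n \<phi>1n \<phi>n1 \<phi>11 C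
      = {x \<in> carrier_mat 1 n. \<forall>c\<in>C. row_inv n \<phi>1n x * col_inv n \<phi>n1 (transpose_mat c) = 0\<^sub>m 1 1}"
    using C unfolding left_star_perp_def
    by (auto simp: star_prod_eq_zero_iff[OF \<phi>] subset_iff simp del: One_nat_def)
  moreover have "perp_of_cols n Y = {x \<in> row_inv n \<phi>1n ` carrier_mat 1 n. \<forall>y\<in>Y. x * y = 0\<^sub>m 1 1}" for Y
    unfolding perp_of_cols_def img ..
  ultimately show ?thesis
    by auto
qed

theorem corollary2p11:
  fixes n :: nat
    and \<phi>1n \<phi>n1 \<phi>11 :: "'a :: {ring, monoid_mult} mat \<Rightarrow> 'a mat"
    and C :: "'a mat set"
  assumes "n \<ge> 1"
    and "additive_automorphism 1 n \<phi>1n"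
    and "additive_automorphism n 1 \<phi>n1"
    and "additive_automorphism 1 1 \<phi>11"
    and "C \<subseteq> carrier_mat 1 n"
  shows "(C = right_star_perp n \<phi>1n \<phi>n1 \<phi>11 C \<longleftrightarrow>
           col_inv n \<phi>n1 ` (transpose_mat ` C) = perp_of_rows n (row_inv n \<phi>1n ` C)) \<and>
         (C = left_star_perp n \<phi>1n \<phi>n1 \<phi>11 C \<longrightarrow>
           row_inv n \<phi>1n ` C = perp_of_cols n (col_inv n \<phi>n1 ` (transpose_mat ` C)))"
proof
  have "inj_on (col_inv n \<phi>n1 \<circ> transpose_mat) (carrier_mat 1 n)"
    using bij_betw_transpose_mat additive_automorphism_inv_bij_betw[OF assms(3)]
    by (intro bij_betw_imp_inj_on bij_betw_trans)
  moreover have "right_star_perp n \<phi>1n \<phi>n1 \<phi>11 C \<subseteq> carrier_mat 1 n"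
    unfolding right_star_perp_def by (rule Collect_restrict)
  ultimately have "col_inv n \<phi>n1 ` (transpose_mat ` C)
        = col_inv n \<phi>n1 ` (transpose_mat ` right_star_perp n \<phi>1n \<phi>n1 \<phi>11 C)
      \<longleftrightarrow> C = right_star_perp n \<phi>1n \<phi>n1 \<phi>11 C"
    unfolding image_comp using assms(5) by (simp only: inj_on_image_eq_iff)
  then show "C = right_star_perp n \<phi>1n \<phi>n1 \<phi>11 C \<longleftrightarrow>
      col_inv n \<phi>n1 ` (transpose_mat ` C) = perp_of_rows n (row_inv n \<phi>1n ` C)"
    unfolding col_inv_image_right_star_perp[OF assms(2-5)] by (rule sym)
next
  show "C = left_star_perp n \<phi>1n \<phi>n1 \<phi>11 C \<longrightarrow>
      row_inv n \<phi>1n ` C = perp_of_cols n (col_inv n \<phi>n1 ` (transpose_mat ` C))"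
    using row_inv_image_left_star_perp[OF assms(2-5)] by metis
qed

end
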